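(* Let $g=\sum_{n\ge 0}x^{n^{2}}\in\mathbb{Z}/2[[x]]$, write $\frac{1}{g}=\sum_{i\ge 0}b_{i}x^{i}$ with $b_{i}\in\mathbb{Z}/2$, and let $B=\{n\ge 0: b_{n}=1\}$. Let $n\equiv 7\pmod{16}$ and let $R_3$ be the number of ordered triples $(s_1,s_2,s_3)$ of squares of integers with $2n=s_1+s_2+s_3$. Then $n\in B$ if and only if $R_3\equiv 2\pmod 4$.
   Context: $\mathbb{Z}/2[[x]]$ is the ring of formal power series over the field with two elements; $g$ has constant term $1$ and so is invertible there. "Squares of integers" means elements of $\{0,1,4,9,\dots\}$; triples are counted as tuples of these square values. *)

theory Defs
  imports
    "HOL-Library.Z2"
    "HOL-Computational_Algebra.Formal_Power_Series"
    "HOL-Computational_Algebra.Nth_Powers"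
    "HOL-Number_Theory.Cong"
begin

unbundle fps_syntax

text \<open>The field $\mathbb{Z}/2$ is the library type \<^typ>\<open>bit\<close>.\<close>

definition g :: "bit fps" where
  "g = Abs_fps (\<lambda>m. of_bool (is_square m))"

text \<open>The coefficientwise definition is the sum of $x^{n^2}$ over all natural numbers $n$
  in the topology of formal power series.\<close>

lemma g_sums: "(\<lambda>n. fps_X ^ (n\<^sup>2)) sums g"
  unfolding sums_def
proof (rule tendsto_fpsI)
  fix m :: nat
  have coeff: "(\<Sum>i<k. fps_X ^ (i\<^sup>2)) $ m = g $ m" if "m < k" for k
  proof (cases "is_square m")
    case True
    then obtain j where j: "m = j\<^sup>2"
      by (auto simp: is_nth_power_def)
    have "j \<le> m"
      unfolding j by (simp add: power2_nat_le_imp_le power2_eq_square)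
    with that have "j < k" by simp
    have "(\<Sum>i<k. fps_X ^ (i\<^sup>2)) $ m = (\<Sum>i<k. if i = j then 1 else (0::bit))"
      unfolding fps_sum_nth by (intro sum.cong) (auto simp: j fps_X_power_nth)
    with \<open>j < k\<close> True show ?thesis
      by (simp add: g_def)
  next
    case False
    then have "(\<Sum>i<k. fps_X ^ (i\<^sup>2)) $ m = (0::bit)"
      unfolding fps_sum_nth by (intro sum.neutral) (auto simp: fps_X_power_nth is_nth_power_def)
    with False show ?thesis
      by (simp add: g_def)
  qed
  show "eventually (\<lambda>k. (\<Sum>i<k. fps_X ^ (i\<^sup>2)) $ m = g $ m) sequentially"
    using eventually_gt_at_top[of m] by eventually_elim (rule coeff)
qed

lemma g_times_inverse: "g * inverse g = 1"
  by (rule inverse_mult_eq_1') (simp add: g_def)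

definition b :: "nat \<Rightarrow> bit" where
  "b i = inverse g $ i"

definition B :: "nat set" where
  "B = {n. b n = 1}"

text \<open>Triples of square values, not of their roots. A natural number is the square of an integer
  iff it is the square of a natural number, so \<^const>\<open>is_nth_power\<close> on naturals is used.\<close>

definition R3 :: "nat \<Rightarrow> nat" where
  "R3 n = card {(s1, s2, s3). is_square s1 \<and> is_square s2 \<and> is_square s3 \<and> 2 * n = s1 + s2 + s3}"

end

theory Submission
  imports Defs
begin

text \<open>
  Let $h$ be the sum of $x^{u^2}$ over odd $u > 0$, so that $g = h + g^4$. Comparing residues of
  exponents modulo 16 in $1/g = g^{15}/g^{16}$, the part of $1/g$ with exponents
  $7$ modulo $16$ is that of $h^7 g^8/g^{16}$. The heart of the matter is that $h g^8$ and $h g^{16}$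
  agree in exponents $1$ modulo $16$: then $1/g$ and $h^7 = h h^2 h^4$ agree in
  exponents $7$ modulo $16$, so $b_n$ is the parity of the number of $(u, c, w)$, odd and positive,
  with $n = u^2 + 2c^2 + 4w^2$. Since $2(u^2 + 4w^2) = (2w - u)^2 + (2w + u)^2$, this number is
  $R_3/6$.

  With $\varphi(q) = \sum_{n \in \mathbb{Z}} q^{n^2}$ and $\psi(q) = \sum_{k \ge 0} q^{k(k+1)/2}$,
  the coincidence of $h g^8$ and $h g^{16}$ follows from the identity
  $\varphi(q)\psi(-q) = \varphi(-q^2)\psi(q)$ over the integers at $q = x^8$, read modulo 4: in
  exponents $1$ modulo $16$ the terms with $n = 0$ agree on both sides, and all others come in
  pairs $\pm n$. Both sides have the same square because $\varphi(q)\psi(q^2) = \psi(q)^2$ and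
  $\varphi(q)\varphi(-q) = \varphi(-q^2)^2$, which are changes of lattice coordinates.
\<close>

section \<open>Generating functions of weighted index sets\<close>

text \<open>Arbitrary index sets allow identities between products to be proved by bijections of the
  indices. Over an infinite fibre \<open>sum\<close> defaults to 0, hence the finiteness assumptions
  wherever sums are split or merged.\<close>

definition gf :: "'a set \<Rightarrow> ('a \<Rightarrow> nat) \<Rightarrow> ('a \<Rightarrow> 'b::comm_ring_1) \<Rightarrow> 'b fps" where
  "gf S e s = Abs_fps (\<lambda>m. \<Sum>p | p \<in> S \<and> e p = m. s p)"

lemma gf_nth: "gf S e s $ m = (\<Sum>p | p \<in> S \<and> e p = m. s p)"
  by (simp add: gf_def)

text \<open>Pairs of total exponent m are grouped by the exponent i of the first component. Each
  group is a product of two fibres, and finiteness lets the disjoint groups be merged into one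
  sum.\<close>

lemma gf_mult:
  assumes "\<And>m. finite {p \<in> S. e p = m}" "\<And>m. finite {q \<in> T. e' q = m}"
  shows "gf S e s * gf T e' s' =
    gf (S \<times> T) (\<lambda>p. e (fst p) + e' (snd p)) (\<lambda>p. s (fst p) * s' (snd p))"
proof (rule fps_ext)
  fix m
  let ?A = "\<lambda>i. {p \<in> S. e p = i} \<times> {q \<in> T. e' q = m - i}"
  have "(gf S e s * gf T e' s') $ m = (\<Sum>i = 0..m. \<Sum>p\<in>?A i. s (fst p) * s' (snd p))"
    by (simp add: fps_mult_nth gf_nth sum_product sum.cartesian_product case_prod_unfold)
  also have "\<dots> = (\<Sum>p\<in>(\<Union>i\<in>{0..m}. ?A i). s (fst p) * s' (snd p))"
    by (rule sum.UNION_disjoint[symmetric]) (use assms in auto)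
  also have "(\<Union>i\<in>{0..m}. ?A i) = {p \<in> S \<times> T. e (fst p) + e' (snd p) = m}"
    by auto
  finally show "(gf S e s * gf T e' s') $ m = gf (S \<times> T) (\<lambda>p. e (fst p) + e' (snd p))
      (\<lambda>p. s (fst p) * s' (snd p)) $ m"
    by (simp add: gf_nth)
qed

lemma gf_reindex:
  assumes "bij_betw f S T" "\<And>p. p \<in> S \<Longrightarrow> e' (f p) = e p" "\<And>p. p \<in> S \<Longrightarrow> s' (f p) = s p"
  shows "gf S e s = gf T e' s'"
proof (rule fps_ext)
  fix m
  have "bij_betw f {p \<in> S. e p = m} {p \<in> T. e' p = m}"
    using assms(1,2) by (fastforce simp: bij_betw_def inj_on_def)
  then show "gf S e s $ m = gf T e' s' $ m"
    unfolding gf_nth using assms(3) by (subst sum.reindex_bij_betw[symmetric]) (auto intro: sum.cong)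
qed

section \<open>Theta series with quadratic exponents\<close>

lemma finite_abs_le: "finite {n :: int. \<bar>n\<bar> \<le> m}"
  by (rule finite_subset[of _ "{-m..m}"]) auto

lemma abs_le_square_int: "\<bar>n\<bar> \<le> n\<^sup>2" for n :: int
proof (cases "n = 0")
  case False
  then have "\<bar>n\<bar> * 1 \<le> \<bar>n\<bar> * \<bar>n\<bar>" by (intro mult_left_mono) auto
  then show ?thesis by (simp add: power2_eq_square flip: abs_mult)
qed simp

lemma finite_square_fibre:
  fixes k :: int
  assumes "k > 0"
  shows "finite {n \<in> S. nat (k * n\<^sup>2) = m}"
proof (rule finite_subset[OF _ finite_abs_le[of "int m"]], safe)
  fix n :: int
  have "1 * n\<^sup>2 \<le> k * n\<^sup>2" using assms by (intro mult_right_mono) auto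
  then show "\<bar>n\<bar> \<le> int (nat (k * n\<^sup>2))"
    using abs_le_square_int[of n] assms by simp
qed

text \<open>Each odd square has exactly one square root congruent to 1 modulo 4.\<close>

definition C :: "int set" where
  "C = {u. u mod 4 = 1}"

definition sgn2 :: "int \<Rightarrow> int" where
  "sgn2 n = (if even n then 1 else -1)"

text \<open>On \<open>C\<close> this is the sign (-1)^((u^2 - 1)/8), so \<open>theta C 1 chi\<close>
  is x psi(-x^8).\<close>

definition chi :: "int \<Rightarrow> int" where
  "chi u = (if u mod 8 = 1 then 1 else -1)"

text \<open>With q = x^8 and constant weight 1, \<open>theta UNIV 8\<close> is phi(q),
  \<open>theta C 1\<close> is x psi(q) and \<open>theta C 2\<close> is x^2 psi(q^2). With weight
  \<open>sgn2\<close>, \<open>theta UNIV 8\<close> is phi(-q) and \<open>theta UNIV 16\<close> is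
  phi(-q^2).\<close>

abbreviation theta :: "int set \<Rightarrow> int \<Rightarrow> (int \<Rightarrow> 'b::comm_ring_1) \<Rightarrow> 'b fps" where
  "theta S k s \<equiv> gf S (\<lambda>n. nat (k * n\<^sup>2)) s"

text \<open>The rotation $(u + 2n, u - 2n)$, with $u$ replaced by $-u$ for odd $n$ so that both
  coordinates stay congruent to 1 modulo 4.\<close>

definition rot :: "int \<times> int \<Rightarrow> int \<times> int" where
  "rot p = (let u = fst p; n = snd p in
     if even n then (u + 2 * n, u - 2 * n) else (2 * n - u, - 2 * n - u))"

section \<open>The rotation as a bijection of index sets\<close>

lemma C_cases:
  assumes "u \<in> C"
  obtains i where "u = 4 * i + 1"
proof
  show "u = 4 * (u div 4) + 1" using assms div_mult_mod_eq[of u 4] by (simp add: C_def)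
qed

text \<open>If (a, c) is the image of (u, n), then a - c = 4n for either parity of n, while a + c is
  2u for even n and -2u for odd n. So n is recovered first, and its parity gives the sign of
  u.\<close>

lemma bij_rot: "bij_betw rot (C \<times> UNIV) (C \<times> C)"
proof (rule bij_betw_byWitness)
  let ?r = "\<lambda>(a, c). let n = (a - c) div 4 in (if even n then (a + c) div 2 else - ((a + c) div 2), n)"
  show "\<forall>p\<in>C \<times> UNIV. ?r (rot p) = p"
    by (auto simp: rot_def Let_def)
  \<comment> \<open>With a = 4i + 1 and c = 4j + 1 both divisions in the inverse are exact.\<close>
  have r: "?r p = (if even (i - j) then 2 * i + 2 * j + 1 else - (2 * i + 2 * j + 1), i - j)"
    if "p = (4 * i + 1, 4 * j + 1)" for p and i j :: int
  proof -
    have "(fst p - snd p) div 4 = i - j" "(fst p + snd p) div 2 = 2 * i + 2 * j + 1"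
      by (simp_all add: that)
    then show ?thesis by (simp add: case_prod_unfold Let_def)
  qed
  show "\<forall>p\<in>C \<times> C. rot (?r p) = p"
  proof
    fix p assume "p \<in> C \<times> C"
    then obtain i j where p: "p = (4 * i + 1, 4 * j + 1)" by (metis C_cases mem_Sigma_iff surj_pair)
    show "rot (?r p) = p"
      unfolding r[OF p] by (simp add: rot_def Let_def p)
  qed
  show "rot ` (C \<times> UNIV) \<subseteq> C \<times> C"
  proof
    fix q assume "q \<in> rot ` (C \<times> UNIV)"
    then obtain u n where q: "q = rot (u, n)" and "u \<in> C" by auto
    then have u: "u mod 4 = 1" by (simp add: C_def)
    show "q \<in> C \<times> C"
    proof (cases "even n")
      case True
      then have "(u + 2 * n) mod 4 = 1" "(u - 2 * n) mod 4 = 1" using u by presburger+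
      with True show ?thesis by (simp add: q rot_def C_def)
    next
      case False
      then have "(2 * n - u) mod 4 = 1" "(- 2 * n - u) mod 4 = 1" using u by presburger+
      with False show ?thesis by (simp add: q rot_def C_def)
    qed
  qed
  show "?r ` (C \<times> C) \<subseteq> C \<times> UNIV"
  proof
    fix q assume "q \<in> ?r ` (C \<times> C)"
    then obtain p where "p \<in> C \<times> C" and q: "q = ?r p" by auto
    then obtain i j where p: "p = (4 * i + 1, 4 * j + 1)" by (metis C_cases mem_Sigma_iff surj_pair)
    \<comment> \<open>i - j and i + j have the same parity, and 2(i + j) + 1 is 1 modulo 4 exactly
      when i + j is even; otherwise its negative is.\<close>
    have "(if even (i - j) then 2 * i + 2 * j + 1 else - (2 * i + 2 * j + 1)) mod 4 = 1"
    proof (cases "even (i - j)")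
      case True
      then have "even (i + j)" by simp
      then obtain k where "i + j = 2 * k" by (elim evenE)
      then have "2 * i + 2 * j + 1 = 4 * k + 1" by simp
      with True show ?thesis by simp
    next
      case False
      then have "odd (i + j)" by simp
      then obtain k where "i + j = 2 * k + 1" by (elim oddE)
      then have eq: "- (2 * i + 2 * j + 1) = 4 * (- k - 1) + 1" by simp
      show ?thesis unfolding if_not_P[OF False] eq by presburger
    qed
    then show "q \<in> C \<times> UNIV" unfolding q r[OF p] by (simp add: C_def)
  qed
qed

text \<open>Exponents are sums of separate \<open>nat\<close> terms; all terms being nonnegative, an
  identity of quadratic forms over the integers passes to them.\<close>

lemma nat_add_squares:
  fixes x y z w :: int
  assumes "k * x\<^sup>2 + l * y\<^sup>2 = k' * z\<^sup>2 + l' * w\<^sup>2" "k \<ge> 0" "l \<ge> 0" "k' \<ge> 0" "l' \<ge> 0"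
  shows "nat (k * x\<^sup>2) + nat (l * y\<^sup>2) = nat (k' * z\<^sup>2) + nat (l' * w\<^sup>2)"
  using assms by (metis nat_add_distrib mult_nonneg_nonneg zero_le_power2)

lemma rot_exponent: "nat (1 * (fst (rot p))\<^sup>2) + nat (1 * (snd (rot p))\<^sup>2) =
    nat (2 * (fst p)\<^sup>2) + nat (8 * (snd p)\<^sup>2)"
  by (rule nat_add_squares) (simp_all add: rot_def Let_def power2_eq_square algebra_simps)

lemma chi_4: "chi (4 * i + 1) = sgn2 i"
proof -
  have "(4 * i + 1) mod 8 = 1 \<longleftrightarrow> even i" by presburger
  then show ?thesis by (simp add: chi_def sgn2_def)
qed

text \<open>By \<open>chi_4\<close> the product is -1 to the power of the sum of the two indices.
  For u = 4i + 1 this sum is 2i when n is even and -2i - 1 when n is odd.\<close>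

lemma rot_chi:
  assumes "p \<in> C \<times> UNIV"
  shows "chi (fst (rot p)) * chi (snd (rot p)) = sgn2 (snd p)"
proof -
  obtain i n where p: "p = (4 * i + 1, n)" using assms by (metis C_cases mem_Sigma_iff surj_pair)
  show ?thesis
  proof (cases "even n")
    case True
    then obtain k where "n = 2 * k" by blast
    then have "rot p = (4 * (i + k) + 1, 4 * (i - k) + 1)" by (simp add: p rot_def Let_def)
    then show ?thesis using True by (simp only: fst_conv snd_conv chi_4) (simp add: sgn2_def p)
  next
    case False
    then obtain k where "n = 2 * k + 1" by (elim oddE)
    then have "rot p = (4 * (k - i) + 1, 4 * (- k - i - 1) + 1)" by (simp add: p rot_def Let_def)
    then show ?thesis using False by (simp only: fst_conv snd_conv chi_4) (simp add: sgn2_def p)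
  qed
qed

section \<open>Product identities for theta series over the integers\<close>

lemma theta_mult:
  assumes "k > 0" "l > 0"
  shows "theta S k s * theta T l t = gf (S \<times> T)
    (\<lambda>p. nat (k * (fst p)\<^sup>2) + nat (l * (snd p)\<^sup>2)) (\<lambda>p. s (fst p) * t (snd p))"
  using assms by (intro gf_mult finite_square_fibre)

text \<open>This is psi(q^2) phi(q) = psi(q)^2 times x^2, from 2u^2 + 8n^2 = (u + 2n)^2 + (u -
  2n)^2.\<close>

lemma theta_rot: "theta C 2 (\<lambda>_. 1 :: int) * theta UNIV 8 (\<lambda>_. 1) = theta C 1 (\<lambda>_. 1) ^ 2"
  unfolding power2_eq_square[of "gf _ _ _"] theta_mult[OF zero_less_numeral zero_less_numeral]
    theta_mult[OF zero_less_one zero_less_one]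
  by (rule gf_reindex[OF bij_rot], rule rot_exponent) simp

text \<open>The preceding identity with -q for q: psi(q^2) phi(-q) = psi(-q)^2, times x^2.\<close>

lemma theta_rot_chi: "theta C 2 (\<lambda>_. 1) * theta UNIV 8 sgn2 = theta C 1 chi ^ 2"
  unfolding power2_eq_square[of "gf _ _ _"] theta_mult[OF zero_less_numeral zero_less_numeral]
    theta_mult[OF zero_less_one zero_less_one]
  by (rule gf_reindex[OF bij_rot], rule rot_exponent) (simp add: rot_chi)

text \<open>This is phi(q) phi(-q) = phi(-q^2)^2. Pairs with odd coordinate sum cancel; the others
  are (x + y, x - y), where the exponent becomes 16x^2 + 16y^2 and the sign of x - y is the product
  of the signs of x and y.\<close>

lemma theta_sgn2: "theta UNIV 8 (\<lambda>_. 1) * theta UNIV 8 sgn2 = theta UNIV 16 sgn2 ^ 2"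
proof -
  let ?e = "\<lambda>p::int \<times> int. nat (8 * (fst p)\<^sup>2) + nat (8 * (snd p)\<^sup>2)"
  let ?E = "{p::int \<times> int. even (fst p + snd p)}"
  let ?f = "\<lambda>p::int \<times> int. (fst p + snd p, fst p - snd p)"
  have bij: "bij_betw ?f (UNIV \<times> UNIV) ?E"
    by (rule bij_betw_byWitness[where f' = "\<lambda>p. ((fst p + snd p) div 2, (fst p - snd p) div 2)"])
      (auto elim!: evenE simp: algebra_simps, presburger+)
  have even_part: "gf (UNIV \<times> UNIV) (\<lambda>p. nat (16 * (fst p)\<^sup>2) + nat (16 * (snd p)\<^sup>2))
      (\<lambda>p. sgn2 (fst p) * sgn2 (snd p)) = gf ?E ?e (\<lambda>p. sgn2 (snd p))"
    by (rule gf_reindex[OF bij])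
      (rule nat_add_squares, auto simp: sgn2_def power2_eq_square algebra_simps)
  have fin: "finite {p. ?e p = m}" for m
  proof (rule finite_subset)
    show "{p. ?e p = m} \<subseteq> {n. \<bar>n\<bar> \<le> int m} \<times> {n. \<bar>n\<bar> \<le> int m}"
    proof
      fix p assume "p \<in> {p. ?e p = m}"
      then have "8 * (fst p)\<^sup>2 + 8 * (snd p)\<^sup>2 = int m" by auto
      then show "p \<in> {n. \<bar>n\<bar> \<le> int m} \<times> {n. \<bar>n\<bar> \<le> int m}"
        using abs_le_square_int[of "fst p"] abs_le_square_int[of "snd p"] by (auto simp: mem_Times_iff)
    qed
  qed (simp add: finite_abs_le)
  have odd_part: "(\<Sum>p | odd (fst p + snd p) \<and> ?e p = m. sgn2 (snd p)) = 0" (is "?L = 0") for m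
  proof -
    \<comment> \<open>Swapping the coordinates preserves the exponent, and coordinates of opposite
      parity have opposite signs, so the sum is its own negative.\<close>
    have "?L = (\<Sum>p | odd (fst p + snd p) \<and> ?e p = m. sgn2 (fst p))"
      by (rule sum.reindex_bij_witness[where i = prod.swap and j = prod.swap])
        (auto simp: add.commute)
    also have "\<dots> = (\<Sum>p | odd (fst p + snd p) \<and> ?e p = m. - sgn2 (snd p))"
      by (rule sum.cong) (auto simp: sgn2_def)
    finally show ?thesis by (simp add: sum_negf)
  qed
  have "gf (UNIV \<times> UNIV) ?e (\<lambda>p. 1 * sgn2 (snd p)) = gf ?E ?e (\<lambda>p. sgn2 (snd p))"
  proof (rule fps_ext)
    fix m
    let ?O = "{p. odd (fst p + snd p) \<and> ?e p = m}"
    have "{p. ?e p = m} = {p \<in> ?E. ?e p = m} \<union> ?O"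
      by auto
    then have "(\<Sum>p | ?e p = m. sgn2 (snd p)) = (\<Sum>p\<in>{p \<in> ?E. ?e p = m} \<union> ?O. sgn2 (snd p))"
      by (rule arg_cong)
    also have "\<dots> = (\<Sum>p\<in>{p \<in> ?E. ?e p = m}. sgn2 (snd p)) + (\<Sum>p\<in>?O. sgn2 (snd p))"
    proof (rule sum.union_disjoint)
      show "finite {p \<in> ?E. ?e p = m}" "finite ?O"
        by (rule finite_subset[OF _ fin[of m]]; simp add: subset_iff)+
    qed auto
    finally show "gf (UNIV \<times> UNIV) ?e (\<lambda>p. 1 * sgn2 (snd p)) $ m = gf ?E ?e (\<lambda>p. sgn2 (snd p)) $ m"
      unfolding gf_nth odd_part by simp
  qed
  with even_part show ?thesis
    unfolding power2_eq_square[of "gf _ _ _"] theta_mult[OF zero_less_numeral zero_less_numeral]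
    by simp
qed

text \<open>This is $\varphi(q)\psi(-q) = \varphi(-q^2)\psi(q)$ at $q = x^8$, multiplied by $x$.\<close>

lemma theta_identity: "theta C 1 chi * theta UNIV 8 (\<lambda>_. 1) = theta C 1 (\<lambda>_. 1) * theta UNIV 16 sgn2"
  (is "?X = ?Y")
proof -
  \<comment> \<open>The square is x^2 psi(q^2) phi(-q) phi(q)^2, regrouped so that the two factors
    are x^2 psi(q)^2 and phi(-q^2)^2.\<close>
  have "?X ^ 2 = (theta C 2 (\<lambda>_. 1) * theta UNIV 8 (\<lambda>_. 1)) *
      (theta UNIV 8 (\<lambda>_. 1) * theta UNIV 8 sgn2)"
    by (simp only: power_mult_distrib theta_rot_chi[symmetric] power2_eq_square[of "theta UNIV 8 _"] mult_ac)
  then have "?X ^ 2 = ?Y ^ 2"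
    by (simp only: theta_sgn2 theta_rot power_mult_distrib)
  then have "?X = ?Y \<or> ?X = - ?Y"
    by (simp add: power2_eq_iff)
  \<comment> \<open>Only (1, 0) contributes to the coefficient of x, which is therefore 1 on both
    sides; this excludes the negative sign.\<close>
  moreover have supp: "{p \<in> C \<times> (UNIV::int set). nat (1 * (fst p)\<^sup>2) + nat (k * (snd p)\<^sup>2) = m} = {(1, 0)}"
    if "m = 1" "k > 1" for m :: nat and k
  proof -
    have "{p \<in> C \<times> UNIV. nat (1 * (fst p)\<^sup>2) + nat (k * (snd p)\<^sup>2) = m} \<subseteq> {(1, 0)}"
    proof
      fix p assume "p \<in> {p \<in> C \<times> UNIV. nat (1 * (fst p)\<^sup>2) + nat (k * (snd p)\<^sup>2) = m}"
      then have p: "fst p \<in> C" "nat (1 * (fst p)\<^sup>2) + nat (k * (snd p)\<^sup>2) = m" by auto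
      have eq: "(fst p)\<^sup>2 + k * (snd p)\<^sup>2 = 1"
        using p(2) \<open>k > 1\<close> \<open>m = 1\<close> by (simp add: nat_add_distrib[symmetric])
      have "snd p = 0"
      proof (rule ccontr)
        assume "snd p \<noteq> 0"
        then have "1 \<le> (snd p)\<^sup>2" using abs_le_square_int[of "snd p"] by linarith
        then have "k * 1 \<le> k * (snd p)\<^sup>2" using \<open>k > 1\<close> by (intro mult_left_mono) auto
        with eq \<open>k > 1\<close> zero_le_power2[of "fst p"] show False by linarith
      qed
      moreover from this eq have "fst p = 1 \<or> fst p = -1" by (simp add: power2_eq_1_iff)
      ultimately show "p \<in> {(1, 0)}" using p(1) by (auto simp: C_def prod_eq_iff)
    qed
    moreover have "(1, 0) \<in> {p \<in> C \<times> (UNIV::int set). nat (1 * (fst p)\<^sup>2) + nat (k * (snd p)\<^sup>2) = m}"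
      using \<open>m = 1\<close> by (simp add: C_def)
    ultimately show ?thesis by blast
  qed
  have "(1 :: int) < 8" "(1 :: int) < 16" by simp_all
  note supp = this[THEN supp[OF refl]]
  have "?X $ 1 = 1"
    by (simp only: theta_mult gf_nth supp zero_less_numeral zero_less_one) (simp add: chi_def)
  moreover have "?Y $ 1 = 1"
    by (simp only: theta_mult gf_nth supp zero_less_numeral zero_less_one) (simp add: sgn2_def)
  ultimately show ?thesis by (metis fps_neg_nth one_neq_neg_one)
qed

section \<open>Reduction modulo 2 in exponents 1 modulo 16\<close>

lemma finite_theta_fibre:
  assumes "k > 0" "l > 0"
  shows "finite {p \<in> S \<times> T. nat (k * (fst p)\<^sup>2) + nat (l * (snd p)\<^sup>2) = m}"
proof (rule finite_subset)
  show "{p \<in> S \<times> T. nat (k * (fst p)\<^sup>2) + nat (l * (snd p)\<^sup>2) = m} \<subseteq>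
      (\<Union>i\<le>m. {n \<in> S. nat (k * n\<^sup>2) = i}) \<times> (\<Union>i\<le>m. {n \<in> T. nat (l * n\<^sup>2) = i})"
    by auto
  show "finite ((\<Union>i\<le>m. {n \<in> S. nat (k * n\<^sup>2) = i}) \<times> (\<Union>i\<le>m. {n \<in> T. nat (l * n\<^sup>2) = i}))"
    by (intro finite_cartesian_product finite_UN_I finite_atMost finite_square_fibre assms)
qed

text \<open>The index 0 is set apart, and n and -n contribute equally.\<close>

lemma theta_mult_even_weight:
  fixes s t :: "int \<Rightarrow> int"
  assumes "k > 0" "\<And>n. t (- n) = t n"
  shows "(theta S 1 s * theta UNIV k t) $ m =
    (\<Sum>u | u \<in> S \<and> nat (u\<^sup>2) = m. s u * t 0) + 2 * (theta S 1 s * theta {0<..} k t) $ m"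
proof -
  let ?F = "\<lambda>T. {p. p \<in> S \<times> T \<and> nat (1 * (fst p)\<^sup>2) + nat (k * (snd p)\<^sup>2) = m}"
  let ?s = "\<lambda>p. s (fst p) * t (snd p)"
  have fin: "finite (?F T)" for T
    using finite_theta_fibre[of 1 k S T m] assms by simp
  have "?F UNIV = ?F {0} \<union> (?F {0<..} \<union> ?F {..<0})"
    by auto
  then have "(\<Sum>p\<in>?F UNIV. ?s p) = (\<Sum>p\<in>?F {0} \<union> (?F {0<..} \<union> ?F {..<0}). ?s p)"
    by (rule arg_cong)
  also have "\<dots> = (\<Sum>p\<in>?F {0}. ?s p) + (\<Sum>p\<in>?F {0<..} \<union> ?F {..<0}. ?s p)"
    by (rule sum.union_disjoint) (use fin in auto)
  also have "(\<Sum>p\<in>?F {0<..} \<union> ?F {..<0}. ?s p) = (\<Sum>p\<in>?F {0<..}. ?s p) + (\<Sum>p\<in>?F {..<0}. ?s p)"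
    by (rule sum.union_disjoint) (use fin in auto)
  also have "(\<Sum>p\<in>?F {..<0}. ?s p) = (\<Sum>p\<in>?F {0<..}. ?s p)"
    by (rule sum.reindex_bij_witness[where i = "\<lambda>p. (fst p, - snd p)" and j = "\<lambda>p. (fst p, - snd p)"])
      (auto simp: assms)
  also have "(\<Sum>p\<in>?F {0}. ?s p) = (\<Sum>u | u \<in> S \<and> nat (u\<^sup>2) = m. s u * t 0)"
    by (rule sum.reindex_bij_witness[where i = "\<lambda>u. (u, 0)" and j = fst]) auto
  finally show ?thesis
    using assms(1) by (simp only: theta_mult gf_nth zero_less_one)
qed

lemma of_int_gf: "(of_int (gf S e s $ m) :: 'b::comm_ring_1) = gf S e (\<lambda>p. of_int (s p)) $ m"
  by (simp add: gf_nth)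

text \<open>In \<open>theta_identity\<close> the terms with n = 0 agree on both sides in these
  exponents, so twice the sums over n > 0 agree. The factor 2 is cancelled over the integers before
  passing to \<open>bit\<close>, where all signs become 1.\<close>

lemma theta_pos_parity:
  assumes "m mod 16 = 1"
  shows "(theta C 1 (\<lambda>_. 1) * theta {0<..} 8 (\<lambda>_. 1) :: bit fps) $ m =
    (theta C 1 (\<lambda>_. 1) * theta {0<..} 16 (\<lambda>_. 1)) $ m"
proof -
  \<comment> \<open>For u = 4i + 1 the square is 16i^2 + 8i + 1, which is 1 modulo 16 only for even
    i.\<close>
  have chi_1: "chi u = 1" if "u \<in> C" "nat (u\<^sup>2) = m" for u
  proof -
    obtain i where i: "u = 4 * i + 1" using C_cases[OF \<open>u \<in> C\<close>] .
    have "int m = u\<^sup>2" using that by auto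
    also have "\<dots> = 16 * i\<^sup>2 + 8 * i + 1" by (simp add: i power2_eq_square algebra_simps)
    finally have "(16 * i\<^sup>2 + 8 * i + 1) mod 16 = 1" using assms by (metis of_nat_1 of_nat_mod of_nat_numeral)
    then have "even i" by presburger
    then show ?thesis by (simp add: i chi_4 sgn2_def)
  qed
  have "(\<Sum>u | u \<in> C \<and> nat (u\<^sup>2) = m. chi u * 1) = (\<Sum>u | u \<in> C \<and> nat (u\<^sup>2) = m. 1 * sgn2 0)"
    by (rule sum.cong) (auto simp: chi_1 sgn2_def)
  moreover have "(theta C 1 chi * theta UNIV 8 (\<lambda>_. 1)) $ m = (theta C 1 (\<lambda>_. 1) * theta UNIV 16 sgn2) $ m"
    by (simp only: theta_identity)
  ultimately have "(theta C 1 chi * theta {0<..} 8 (\<lambda>_. 1)) $ m = (theta C 1 (\<lambda>_. 1) * theta {0<..} 16 sgn2) $ m"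
    by (subst (asm) (1 2) theta_mult_even_weight) (simp_all add: sgn2_def)
  then have "(of_int ((theta C 1 chi * theta {0<..} 8 (\<lambda>_. 1)) $ m) :: bit) =
      of_int ((theta C 1 (\<lambda>_. 1) * theta {0<..} 16 sgn2) $ m)"
    by (rule arg_cong)
  then show ?thesis
    by (simp only: theta_mult of_int_gf zero_less_numeral zero_less_one of_int_mult)
      (simp add: chi_def sgn2_def if_distrib[of of_int] cong: if_cong)
qed

lemma gf_insert:
  assumes "x \<notin> S" "\<And>m. finite {p \<in> S. e p = m}"
  shows "gf (insert x S) e s = fps_const (s x) * fps_X ^ e x + gf S e s"
proof (rule fps_ext)
  fix m
  have "{p. p \<in> insert x S \<and> e p = m} = (if e x = m then insert x {p \<in> S. e p = m} else {p \<in> S. e p = m})"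
    by auto
  then show "gf (insert x S) e s $ m = (fps_const (s x) * fps_X ^ e x + gf S e s) $ m"
    using assms by (simp add: gf_nth fps_X_power_nth)
qed

text \<open>The index 0 adds the same series \<open>theta C 1\<close> to both sides of
  \<open>theta_pos_parity\<close>.\<close>

lemma theta_parity:
  assumes "m mod 16 = 1"
  shows "(theta C 1 (\<lambda>_. 1) * theta {0..} 8 (\<lambda>_. 1) :: bit fps) $ m =
    (theta C 1 (\<lambda>_. 1) * theta {0..} 16 (\<lambda>_. 1)) $ m"
proof -
  have "theta {0..} k (\<lambda>_. 1) = (1 + theta {0<..} k (\<lambda>_. 1) :: bit fps)" if "k > 0" for k
  proof -
    have "{0 :: int..} = insert 0 {0<..}" by auto
    then have "theta {0..} k (\<lambda>_. 1 :: bit) =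
        fps_const 1 * fps_X ^ nat (k * 0\<^sup>2) + theta {0<..} k (\<lambda>_. 1)"
      using gf_insert[of 0 "{0<..}" "\<lambda>n. nat (k * n\<^sup>2)" "\<lambda>_. 1 :: bit"]
        finite_square_fibre[OF that, of "{0<..}"] by (simp only: greaterThan_iff less_irrefl not_False_eq_True)
    then show ?thesis by simp
  qed
  then show ?thesis
    using theta_pos_parity[OF assms] by (simp add: distrib_left)
qed

section \<open>Squaring in characteristic 2\<close>

text \<open>The terms at i and m - i are equal and cancel, leaving the middle term for even
  m.\<close>

lemma bit_fps_square:
  fixes f :: "bit fps"
  shows "f\<^sup>2 $ m = (if even m then f $ (m div 2) else 0)"
proof -
  let ?t = "\<lambda>i. f $ i * f $ (m - i)"
  have "f\<^sup>2 $ m = (\<Sum>i\<in>{..m}. ?t i)"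
    by (simp add: power2_eq_square fps_mult_nth atMost_atLeast0)
  also have "{..m} = {i. 2 * i < m} \<union> ({i. i \<le> m \<and> 2 * i > m} \<union> {i. 2 * i = m})"
    by auto
  also have "(\<Sum>i\<in>\<dots>. ?t i) = (\<Sum>i | 2 * i < m. ?t i) +
      (\<Sum>i\<in>{i. i \<le> m \<and> 2 * i > m} \<union> {i. 2 * i = m}. ?t i)"
    by (rule sum.union_disjoint) (auto intro: finite_subset[of _ "{..m}"])
  also have "(\<Sum>i\<in>{i. i \<le> m \<and> 2 * i > m} \<union> {i. 2 * i = m}. ?t i) =
      (\<Sum>i | i \<le> m \<and> 2 * i > m. ?t i) + (\<Sum>i | 2 * i = m. ?t i)"
    by (rule sum.union_disjoint) (auto intro: finite_subset[of _ "{..m}"])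
  also have "(\<Sum>i | i \<le> m \<and> 2 * i > m. ?t i) = (\<Sum>i | 2 * i < m. ?t i)"
    by (rule sum.reindex_bij_witness[where i = "\<lambda>i. m - i" and j = "\<lambda>i. m - i"]) (auto simp: mult.commute)
  also have "(\<Sum>i | 2 * i = m. ?t i) = (if even m then f $ (m div 2) else 0)"
  proof (cases "even m")
    case True
    then have "{i. 2 * i = m} = {m div 2}" "m - m div 2 = m div 2" by auto
    \<comment> \<open>In \<open>bit\<close> every element is its own square.\<close>
    with True show ?thesis by (cases "f $ (m div 2)") simp_all
  next
    case False
    then have "{i. 2 * i = m} = {}" by auto
    with False show ?thesis by simp
  qed
  finally have "f\<^sup>2 $ m = (\<Sum>i | 2 * i < m. ?t i) + ((\<Sum>i | 2 * i < m. ?t i) +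
      (if even m then f $ (m div 2) else 0))" .
  moreover have "x + (x + y) = y" for x y :: bit
    by (cases x; cases y) simp_all
  ultimately show ?thesis by (simp only:)
qed

lemma bit_fps_add_square: "(f + f')\<^sup>2 = f\<^sup>2 + f'\<^sup>2" for f f' :: "bit fps"
  by (rule fps_ext) (simp only: bit_fps_square fps_add_nth, simp)

text \<open>Squaring substitutes x^2 for x and so doubles all exponents.\<close>

lemma theta_bit_square:
  assumes "k \<ge> 0"
  shows "(theta S k (\<lambda>_. 1) :: bit fps)\<^sup>2 = theta S (2 * k) (\<lambda>_. 1)"
proof (rule fps_ext)
  fix m
  have double: "nat (2 * k * n\<^sup>2) = 2 * nat (k * n\<^sup>2)" for n
    by (simp add: nat_mult_distrib[of 2, simplified] mult.assoc)
  show "(theta S k (\<lambda>_. 1) :: bit fps)\<^sup>2 $ m = theta S (2 * k) (\<lambda>_. 1) $ m"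
  proof (cases "even m")
    case True
    then obtain j where "m = 2 * j" by blast
    then show ?thesis by (simp add: bit_fps_square gf_nth double)
  next
    case False
    then have "{n \<in> S. nat (2 * k * n\<^sup>2) = m} = {}" by (auto simp: double)
    with False show ?thesis by (simp only: bit_fps_square gf_nth sum.empty if_False)
  qed
qed

section \<open>Grading by exponents modulo d\<close>

text \<open>Homogeneity of degree r in the grading by residues modulo d.\<close>

definition supported :: "nat \<Rightarrow> nat \<Rightarrow> 'a::zero fps \<Rightarrow> bool" where
  "supported d r f \<longleftrightarrow> (\<forall>m. f $ m \<noteq> 0 \<longrightarrow> [m = r] (mod d))"

lemma supported_mult:
  fixes f f' :: "'a::comm_ring_1 fps"
  assumes "supported d r f" "supported d r' f'"
  shows "supported d (r + r') (f * f')"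
  unfolding supported_def
proof safe
  fix m assume "(f * f') $ m \<noteq> 0"
  then obtain i where i: "i \<le> m" "f $ i * f' $ (m - i) \<noteq> 0"
    unfolding fps_mult_nth by (metis (no_types, lifting) atLeastAtMost_iff sum.neutral)
  then have "f $ i \<noteq> 0" "f' $ (m - i) \<noteq> 0" by auto
  then have "[i + (m - i) = r + r'] (mod d)"
    using assms unfolding supported_def by (intro cong_add) auto
  with i show "[m = r + r'] (mod d)" by simp
qed

lemma supported_add:
  fixes f f' :: "'a::comm_ring_1 fps"
  shows "supported d r f \<Longrightarrow> supported d r f' \<Longrightarrow> supported d r (f + f')"
  unfolding supported_def by (metis add.right_neutral fps_add_nth)

lemma supported_dvd: "supported d r f \<Longrightarrow> d' dvd d \<Longrightarrow> [r = r'] (mod d') \<Longrightarrow> supported d' r' f"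
  unfolding supported_def by (meson cong_dvd_modulus_nat cong_trans)

text \<open>The homogeneous component of degree r.\<close>

definition proj :: "nat \<Rightarrow> nat \<Rightarrow> 'a::zero fps \<Rightarrow> 'a fps" where
  "proj d r f = Abs_fps (\<lambda>m. if [m = r] (mod d) then f $ m else 0)"

lemma proj_add: "proj d r (f + f') = proj d r f + proj d r f'" for f :: "'a::comm_ring_1 fps"
  by (simp add: proj_def fps_eq_iff)

text \<open>A homogeneous factor of degree s shifts every component by s.\<close>

lemma proj_mult:
  fixes f f' :: "'a::comm_ring_1 fps"
  assumes "supported d s f'"
  shows "proj d (r + s) (f * f') = proj d r f * f'"
proof (rule fps_ext)
  fix m
  \<comment> \<open>A nonzero coefficient of f' at m - i puts m - i in the class of s, so the
    conditions on m and on i are equivalent.\<close>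
  have "(if [m = r + s] (mod d) then f $ i * f' $ (m - i) else 0) =
      (if [i = r] (mod d) then f $ i else 0) * f' $ (m - i)" if "i \<le> m" for i
  proof (cases "f' $ (m - i) = 0")
    case False
    then have "[m - i = s] (mod d)" using assms by (auto simp: supported_def)
    then have "[m = r + s] (mod d) \<longleftrightarrow> [i + s = r + s] (mod d)"
      using that by (metis cong_add_lcancel_nat cong_sym cong_trans le_add_diff_inverse)
    then show ?thesis by (simp add: cong_add_rcancel_nat)
  qed simp
  then have "(\<Sum>i = 0..m. if [m = r + s] (mod d) then f $ i * f' $ (m - i) else 0) =
      (\<Sum>i = 0..m. (if [i = r] (mod d) then f $ i else 0) * f' $ (m - i))"
    by (intro sum.cong) auto
  then show "proj d (r + s) (f * f') $ m = (proj d r f * f') $ m"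
    unfolding proj_def fps_mult_nth fps_nth_Abs_fps
    by (cases "[m = r + s] (mod d)") simp_all
qed

lemma proj_eq_0:
  assumes "supported d' r' f" "d' dvd d" "\<not> [r = r'] (mod d')"
  shows "proj d r f = 0"
  using assms by (auto simp: proj_def supported_def fps_eq_iff) (meson cong_dvd_modulus_nat cong_sym cong_trans)

section \<open>The series g and h and their powers\<close>

lemma is_square_iff_int: "is_square m \<longleftrightarrow> (\<exists>k::int. int m = k\<^sup>2)"
proof
  assume "is_square m"
  then obtain k where "m = k\<^sup>2" by (auto simp: is_nth_power_def)
  then have "int m = (int k)\<^sup>2" by simp
  then show "\<exists>k::int. int m = k\<^sup>2" ..
next
  assume "\<exists>k::int. int m = k\<^sup>2"
  then obtain k where "int m = k\<^sup>2" ..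
  then have "int m = int ((nat \<bar>k\<bar>)\<^sup>2)" by simp
  then have "m = (nat \<bar>k\<bar>)\<^sup>2" by (simp only: of_nat_eq_iff)
  then show "is_square m" by (auto simp: is_nth_power_def)
qed

lemma g_eq_theta: "g = theta {0..} 1 (\<lambda>_. 1)"
proof (rule fps_ext)
  fix m
  show "g $ m = theta {0..} 1 (\<lambda>_. 1) $ m"
  proof (cases "is_square m")
    case True
    then obtain k where k: "m = k\<^sup>2" by (auto simp: is_nth_power_def)
    have "{n \<in> {0..}. nat (1 * n\<^sup>2) = m} = {int k}"
      by (auto simp: k nat_eq_iff power2_eq_iff_nonneg)
    with True show ?thesis by (simp only: gf_nth sum.insert sum.empty) (simp add: g_def)
  next
    case False
    then have "{n \<in> {0..}. nat (1 * n\<^sup>2) = m} = {}"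
      by (auto simp: is_square_iff_int)
    with False show ?thesis by (simp only: gf_nth sum.empty) (simp add: g_def)
  qed
qed

text \<open>Odd squares are indexed by their roots in \<open>C\<close>, so this is the sum of
  x^(u^2) over odd u > 0.\<close>

definition h :: "bit fps" where
  "h = theta C 1 (\<lambda>_. 1)"

lemma h_powers: "h ^ 2 = theta C 2 (\<lambda>_. 1)" "h ^ 4 = theta C 4 (\<lambda>_. 1)"
proof -
  show 2: "h ^ 2 = theta C 2 (\<lambda>_. 1)" unfolding h_def by (subst theta_bit_square) simp_all
  have "h ^ 4 = (h ^ 2) ^ 2" by (simp flip: power_mult)
  then show "h ^ 4 = theta C 4 (\<lambda>_. 1)" by (simp add: 2 theta_bit_square)
qed

lemma g_powers: "g ^ 4 = theta {0..} 4 (\<lambda>_. 1)" "g ^ 8 = theta {0..} 8 (\<lambda>_. 1)"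
  "g ^ 16 = theta {0..} 16 (\<lambda>_. 1)"
proof -
  have "g ^ 4 = (g ^ 2) ^ 2" "g ^ 8 = ((g ^ 2) ^ 2) ^ 2" "g ^ 16 = (((g ^ 2) ^ 2) ^ 2) ^ 2"
    by (simp_all flip: power_mult)
  moreover have "g ^ 2 = theta {0..} 2 (\<lambda>_. 1)"
    unfolding g_eq_theta by (subst theta_bit_square) simp_all
  ultimately show "g ^ 4 = theta {0..} 4 (\<lambda>_. 1)" "g ^ 8 = theta {0..} 8 (\<lambda>_. 1)"
    "g ^ 16 = theta {0..} 16 (\<lambda>_. 1)"
    by (simp_all add: theta_bit_square)
qed

lemma supported_theta:
  assumes "\<And>n. n \<in> S \<Longrightarrow> (k * n\<^sup>2) mod int d = int r mod int d" "k > 0"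
  shows "supported d r (theta S k s)"
  unfolding supported_def
proof safe
  fix m assume "theta S k s $ m \<noteq> 0"
  then obtain n where "n \<in> S" "nat (k * n\<^sup>2) = m"
    unfolding gf_nth by (metis (mono_tags, lifting) mem_Collect_eq sum.neutral)
  then have "[int m = int r] (mod int d)" using assms by (auto simp: cong_def)
  then show "[m = r] (mod d)" by (simp add: cong_int_iff)
qed

lemma C_odd: "u \<in> C \<Longrightarrow> odd u"
  unfolding C_def mem_Collect_eq by presburger

lemma odd_C_cases: "odd u \<Longrightarrow> u \<in> C \<or> u \<notin> C \<and> - u \<in> C"
  unfolding C_def mem_Collect_eq by presburger

lemma uminus_notin_C: "u \<in> C \<Longrightarrow> - u \<notin> C"
  unfolding C_def mem_Collect_eq by presburger

text \<open>Squares of odd numbers give \<open>h\<close>; those of even numbers 2n give the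
  exponents 4n^2 of \<open>g ^ 4\<close>.\<close>

lemma g_split: "g = h + g ^ 4"
proof (rule fps_ext)
  fix m
  have "bij_betw (\<lambda>n. 2 * n) {n \<in> {0..}. nat (4 * n\<^sup>2) = m} {n \<in> {0..}. even n \<and> nat (n\<^sup>2) = m}"
    by (rule bij_betw_byWitness[where f' = "\<lambda>n. n div 2"]) (auto elim!: evenE simp: power_mult_distrib)
  then have e: "card {n \<in> {0::int..}. nat (4 * n\<^sup>2) = m} = card {n \<in> {0::int..}. even n \<and> nat (n\<^sup>2) = m}"
    by (rule bij_betw_same_card)
  \<comment> \<open>The inverse exists because exactly one of n and -n lies in \<open>C\<close> when
    n is odd.\<close>
  have "bij_betw abs {u \<in> C. nat (u\<^sup>2) = m} {n \<in> {0..}. odd n \<and> nat (n\<^sup>2) = m}"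
    by (rule bij_betw_byWitness[where f' = "\<lambda>n. if n \<in> C then n else - n"])
      (auto simp: abs_if C_odd dest: uminus_notin_C odd_C_cases)
  then have o: "card {u \<in> C. nat (u\<^sup>2) = m} = card {n \<in> {0::int..}. odd n \<and> nat (n\<^sup>2) = m}"
    by (rule bij_betw_same_card)
  have fin: "finite {n \<in> {0::int..}. P n \<and> nat (n\<^sup>2) = m}" for P
    by (rule finite_subset[OF _ finite_square_fibre[of 1 UNIV m]]) auto
  have "{n \<in> {0::int..}. nat (n\<^sup>2) = m} =
      {n \<in> {0..}. odd n \<and> nat (n\<^sup>2) = m} \<union> {n \<in> {0..}. even n \<and> nat (n\<^sup>2) = m}"
    by auto
  then have "card {n \<in> {0::int..}. nat (n\<^sup>2) = m} =
      card ({n \<in> {0::int..}. odd n \<and> nat (n\<^sup>2) = m} \<union> {n \<in> {0..}. even n \<and> nat (n\<^sup>2) = m})"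
    by (rule arg_cong)
  also have "\<dots> = card {n \<in> {0::int..}. odd n \<and> nat (n\<^sup>2) = m} +
      card {n \<in> {0::int..}. even n \<and> nat (n\<^sup>2) = m}"
    by (rule card_Un_disjoint) (use fin in auto)
  finally have "(of_nat (card {n \<in> {0::int..}. nat (1 * n\<^sup>2) = m}) :: bit) =
      of_nat (card {u \<in> C. nat (1 * u\<^sup>2) = m}) + of_nat (card {n \<in> {0::int..}. nat (4 * n\<^sup>2) = m})"
    by (simp only: e o mult_1 flip: of_nat_add)
  then show "g $ m = (h + g ^ 4) $ m"
    by (simp only: g_powers) (simp only: g_eq_theta h_def gf_nth fps_add_nth sum_constant mult_1_right)
qed

lemma C_square_mod:
  assumes "u \<in> C"
  shows "u\<^sup>2 mod 8 = 1" "(2 * u\<^sup>2) mod 16 = 2" "(4 * u\<^sup>2) mod 16 = 4"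
proof -
  obtain i where "u = 4 * i + 1" using assms by (rule C_cases)
  then have u: "u\<^sup>2 = 8 * (2 * i\<^sup>2 + i) + 1" by (simp add: power2_eq_square algebra_simps)
  have "(8 * x + 1) mod 8 = 1" "(2 * (8 * x + 1)) mod 16 = 2" "(4 * (8 * x + 1)) mod 16 = 4" for x :: int
    by presburger+
  then show "u\<^sup>2 mod 8 = 1" "(2 * u\<^sup>2) mod 16 = 2" "(4 * u\<^sup>2) mod 16 = 4"
    unfolding u by blast+
qed

lemma h_supported: "supported 8 1 h" "supported 16 2 (h ^ 2)" "supported 16 4 (h ^ 4)"
proof -
  show "supported 8 1 h" unfolding h_def by (rule supported_theta) (simp_all add: C_square_mod)
  show "supported 16 2 (h ^ 2)" "supported 16 4 (h ^ 4)"
    unfolding h_powers by (rule supported_theta; simp add: C_square_mod)+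
qed

lemma g_supported: "supported 4 0 (g ^ 4)" "supported 8 0 (g ^ 8)" "supported 16 0 (g ^ 16)"
  unfolding g_powers by (rule supported_theta; simp)+

section \<open>The component of 1/g of degree 7 modulo 16\<close>

lemma proj_h: "proj 16 1 (h * g ^ 8) = proj 16 1 (h * g ^ 16)"
proof (rule fps_ext)
  fix m
  have "(h * g ^ 8) $ m = (h * g ^ 16) $ m" if "m mod 16 = 1"
    unfolding g_powers unfolding h_def by (rule theta_parity[OF that])
  then show "proj 16 1 (h * g ^ 8) $ m = proj 16 1 (h * g ^ 16) $ m"
    by (simp add: proj_def cong_def)
qed

lemma supported_g_h: "supported 4 0 (h ^ 4 + g ^ 16)"
  by (intro supported_add; rule supported_dvd[OF h_supported(3)] supported_dvd[OF g_supported(3)]; simp add: cong_def)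

text \<open>Write g^15 = g g^2 g^4 g^8 with g = h + g^4, g^2 = h^2 + g^8 and g^4 = h^4 + g^16.
  Taking h and h^2 but g^16 gives exponents 3 modulo 8; taking h but g^8 gives 1 modulo 4; taking
  g^4 in the first factor gives even exponents. None of these classes contains 7 modulo 16.\<close>

lemma proj_g: "proj 16 7 (g ^ 15) = proj 16 7 (h * h ^ 2 * h ^ 4 * g ^ 8)"
proof -
  have "g ^ 2 = (h + g ^ 4) ^ 2" using g_split by simp
  then have g2: "g ^ 2 = h ^ 2 + g ^ 8" by (simp add: bit_fps_add_square flip: power_mult)
  have "g ^ 4 = (g ^ 2) ^ 2" by (simp flip: power_mult)
  then have g4: "g ^ 4 = h ^ 4 + g ^ 16" by (simp add: g2 bit_fps_add_square flip: power_mult)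
  have "g ^ 15 = g * g ^ 2 * g ^ 4 * g ^ 8" by (simp flip: power_add power_Suc)
  also have "\<dots> = (h + g ^ 4) * (h ^ 2 + g ^ 8) * (h ^ 4 + g ^ 16) * g ^ 8"
    using g_split g2 g4 by simp
  also have "\<dots> = h * h ^ 2 * h ^ 4 * g ^ 8 + h * h ^ 2 * g ^ 16 * g ^ 8 +
      h * g ^ 8 * (h ^ 4 + g ^ 16) * g ^ 8 + g ^ 4 * (h ^ 2 + g ^ 8) * (h ^ 4 + g ^ 16) * g ^ 8"
    by (simp add: algebra_simps)
  finally have eq: "g ^ 15 = h * h ^ 2 * h ^ 4 * g ^ 8 + h * h ^ 2 * g ^ 16 * g ^ 8 +
      h * g ^ 8 * (h ^ 4 + g ^ 16) * g ^ 8 + g ^ 4 * (h ^ 2 + g ^ 8) * (h ^ 4 + g ^ 16) * g ^ 8" .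
  have g16: "supported 8 0 (g ^ 16)" by (rule supported_dvd[OF g_supported(3)]) (simp_all add: cong_def)
  have h2: "supported 8 2 (h ^ 2)" by (rule supported_dvd[OF h_supported(2)]) (simp_all add: cong_def)
  have "supported 8 (1 + 2 + 0 + 0) (h * h ^ 2 * g ^ 16 * g ^ 8)"
    by (intro supported_mult h_supported h2 g16 g_supported)
  then have 1: "proj 16 7 (h * h ^ 2 * g ^ 16 * g ^ 8) = 0"
    by (rule proj_eq_0) (simp_all add: cong_def)
  have g8: "supported 4 0 (g ^ 8)" by (rule supported_dvd[OF g_supported(2)]) (simp_all add: cong_def)
  have h1: "supported 4 1 h" by (rule supported_dvd[OF h_supported(1)]) (simp_all add: cong_def)
  have "supported 4 (1 + 0 + 0 + 0) (h * g ^ 8 * (h ^ 4 + g ^ 16) * g ^ 8)"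
    by (intro supported_mult h1 g8 supported_g_h)
  then have 2: "proj 16 7 (h * g ^ 8 * (h ^ 4 + g ^ 16) * g ^ 8) = 0"
    by (rule proj_eq_0) (simp_all add: cong_def)
  have even: "supported 2 0 (g ^ 4)" "supported 2 0 (h ^ 2)" "supported 2 0 (g ^ 8)" "supported 2 0 (h ^ 4 + g ^ 16)"
    by (rule supported_dvd[OF g_supported(1)] supported_dvd[OF h_supported(2)]
        supported_dvd[OF g_supported(2)] supported_dvd[OF supported_g_h]; simp add: cong_def)+
  have "supported 2 (0 + 0 + 0 + 0) (g ^ 4 * (h ^ 2 + g ^ 8) * (h ^ 4 + g ^ 16) * g ^ 8)"
    by (intro supported_mult supported_add even)
  then have 3: "proj 16 7 (g ^ 4 * (h ^ 2 + g ^ 8) * (h ^ 4 + g ^ 16) * g ^ 8) = 0"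
    by (rule proj_eq_0) (simp_all add: cong_def)
  show ?thesis
    unfolding eq by (simp only: proj_add 1 2 3 add_0_right)
qed

text \<open>Multiplying by \<open>g ^ 16\<close>, of degree 0, turns 1/g into g^15. As h^2 h^4 has
  degree 6, only the component of h g^8 of degree 1 matters; \<open>proj_h\<close> replaces it by
  that of h g^16, and g^16 cancels.\<close>

lemma proj_inverse_g: "proj 16 7 (inverse g) = proj 16 7 (h * h ^ 2 * h ^ 4)"
proof -
  have "inverse g * g ^ 16 = g ^ 15 * (g * inverse g)"
    by (simp add: mult_ac flip: power_Suc2 power_Suc)
  then have inv: "inverse g * g ^ 16 = g ^ 15" by (simp add: g_times_inverse)
  have h6: "supported 16 (2 + 4) (h ^ 2 * h ^ 4)"
    by (intro supported_mult h_supported)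
  have "proj 16 7 (inverse g) * g ^ 16 = proj 16 7 (g ^ 15)"
    using proj_mult[OF g_supported(3), of 7 "inverse g"] by (simp add: inv)
  also have "\<dots> = proj 16 (1 + (2 + 4)) (h * g ^ 8 * (h ^ 2 * h ^ 4))"
    by (simp add: proj_g mult_ac)
  also have "\<dots> = proj 16 1 (h * g ^ 16) * (h ^ 2 * h ^ 4)"
    by (simp only: proj_mult[OF h6] proj_h)
  also have "\<dots> = proj 16 (1 + (2 + 4)) (h * g ^ 16 * (h ^ 2 * h ^ 4))"
    by (simp only: proj_mult[OF h6])
  also have "\<dots> = proj 16 (7 + 0) (h * h ^ 2 * h ^ 4 * g ^ 16)"
    by (simp add: mult_ac)
  also have "\<dots> = proj 16 7 (h * h ^ 2 * h ^ 4) * g ^ 16"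
    by (rule proj_mult[OF g_supported(3)])
  \<comment> \<open>\<open>g ^ 16\<close> can be cancelled since g is invertible, hence
    nonzero.\<close>
  finally show ?thesis
    using g_times_inverse by (auto simp: mult_cancel_right)
qed

section \<open>Coefficients of h^7 as numbers of representations\<close>

text \<open>Roots in \<open>C\<close> stand for the odd positive u, c, w with u^2 + 2c^2 + 4w^2 = n.
  The nested pairs match the index set of the product \<open>h * h ^ 2 * h ^ 4\<close>.\<close>

definition triples :: "nat \<Rightarrow> ((int \<times> int) \<times> int) set" where
  "triples n = {p \<in> (C \<times> C) \<times> C. (fst (fst p))\<^sup>2 + 2 * (snd (fst p))\<^sup>2 + 4 * (snd p)\<^sup>2 = int n}"

lemma h7_nth: "(h * h ^ 2 * h ^ 4) $ n = of_nat (card (triples n))"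
proof -
  have eq: "h * h ^ 2 * h ^ 4 = gf ((C \<times> C) \<times> C)
      (\<lambda>p. nat (1 * (fst (fst p))\<^sup>2) + nat (2 * (snd (fst p))\<^sup>2) + nat (4 * (snd p)\<^sup>2)) (\<lambda>p. 1 * 1 * 1)"
    unfolding h_powers unfolding h_def theta_mult[OF zero_less_one zero_less_numeral]
    by (rule gf_mult) (rule finite_theta_fibre finite_square_fibre; simp)+
  have "{p \<in> (C \<times> C) \<times> C. nat (1 * (fst (fst p))\<^sup>2) + nat (2 * (snd (fst p))\<^sup>2) + nat (4 * (snd p)\<^sup>2) = n} = triples n"
    unfolding triples_def by (rule Collect_cong) (auto simp: nat_add_distrib[symmetric] nat_eq_iff)
  then show ?thesis
    unfolding eq gf_nth by simp
qed

section \<open>Sorting the triples of squares by residues modulo 16\<close>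

definition ordered_triples :: "nat \<Rightarrow> nat \<times> nat \<times> nat \<Rightarrow> (nat \<times> nat \<times> nat) set" where
  "ordered_triples n = (\<lambda>(r1, r2, r3). {(s1, s2, s3). is_square s1 \<and> is_square s2 \<and> is_square s3 \<and>
     2 * n = s1 + s2 + s3 \<and> s1 mod 16 = r1 \<and> s2 mod 16 = r2 \<and> s3 mod 16 = r3})"

lemma finite_ordered_triples: "finite (ordered_triples n r)"
  by (rule finite_subset[of _ "{..2 * n} \<times> {..2 * n} \<times> {..2 * n}"])
    (auto simp: ordered_triples_def split: prod.splits)

lemma square_mod_16: "is_square m \<Longrightarrow> m mod 16 \<in> {0, 1, 4, 9 :: nat}"
proof -
  assume "is_square m"
  then obtain k where k: "m = k\<^sup>2" by (auto simp: is_nth_power_def)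
  have "k mod 16 \<in> {..<16}" by simp
  also have "{..<16} = {0,1,2,3,4,5,6,7,8,9,10,11,12,13,14,15 :: nat}" by (auto simp: numeral_eq_Suc less_Suc_eq)
  finally have "k mod 16 \<in> {0,1,2,3,4,5,6,7,8,9,10,11,12,13,14,15}" .
  moreover have "m mod 16 = (k mod 16)\<^sup>2 mod 16" by (simp add: k power_mod)
  ultimately show ?thesis by (elim insertE emptyE) simp_all
qed

text \<open>Squares are 0, 1, 4 or 9 modulo 16 and 2n is 14. Three such residues add up to at most
  27, so their sum is 14 itself, which forces 1, 4, 9 in some order. The six orders are equally
  frequent by symmetry.\<close>

lemma R3_eq:
  assumes "[n = 7] (mod 16)"
  shows "R3 n = 6 * card (ordered_triples n (1, 9, 4))"
proof -
  let ?I = "{(1, 9, 4), (1, 4, 9), (9, 1, 4), (9, 4, 1), (4, 1, 9), (4, 9, 1)} :: (nat \<times> nat \<times> nat) set"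
  have "n mod 16 = 7" using assms by (simp add: cong_def)
  then obtain q where "n = 16 * q + 7" by (metis mult_div_mod_eq)
  moreover have "2 * (16 * q + 7) mod 16 = (14 :: nat)" by presburger
  ultimately have "2 * n mod 16 = 14" by simp
  then have mod14: "(s1 mod 16 + s2 mod 16 + s3 mod 16) mod 16 = 14" if "2 * n = s1 + s2 + s3" for s1 s2 s3
    using mod_add_cong[OF mod_add_eq mod_mod_trivial, of s1 16 s2 s3] that \<open>2 * n mod 16 = 14\<close> by simp
  have "{(s1, s2, s3). is_square s1 \<and> is_square s2 \<and> is_square s3 \<and> 2 * n = s1 + s2 + s3} =
      (\<Union>r\<in>?I. ordered_triples n r)" (is "?L = ?R")
  proof
    show "?L \<subseteq> ?R"
    proof clarify
      fix s1 s2 s3 assume *: "is_square s1" "is_square s2" "is_square s3" "2 * n = s1 + s2 + s3"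
      have "(s1 mod 16, s2 mod 16, s3 mod 16) \<in> ?I"
        using *(1-3)[THEN square_mod_16] mod14[OF *(4)] by (elim insertE emptyE) simp_all
      with * show "(s1, s2, s3) \<in> ?R"
        by (intro UN_I[of "(s1 mod 16, s2 mod 16, s3 mod 16)"]) (simp_all add: ordered_triples_def)
    qed
  qed (auto simp: ordered_triples_def)
  then have "R3 n = card (\<Union>r\<in>?I. ordered_triples n r)" by (simp only: R3_def)
  also have "\<dots> = (\<Sum>r\<in>?I. card (ordered_triples n r))"
    by (rule card_UN_disjoint) (simp_all add: finite_ordered_triples, auto simp: ordered_triples_def)
  also have "\<dots> = (\<Sum>r\<in>?I. card (ordered_triples n (1, 9, 4)))"
  proof (rule sum.cong[OF refl])
    have swap1: "card (ordered_triples n (a, b, c)) = card (ordered_triples n (b, a, c))" for a b c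
      by (rule bij_betw_same_card[of "\<lambda>(x, y, z). (y, x, z)"],
          rule bij_betw_byWitness[where f' = "\<lambda>(x, y, z). (y, x, z)"]) (auto simp: ordered_triples_def)
    have swap2: "card (ordered_triples n (a, b, c)) = card (ordered_triples n (a, c, b))" for a b c
      by (rule bij_betw_same_card[of "\<lambda>(x, y, z). (x, z, y)"],
          rule bij_betw_byWitness[where f' = "\<lambda>(x, y, z). (x, z, y)"]) (auto simp: ordered_triples_def)
    fix r assume "r \<in> ?I"
    then show "card (ordered_triples n r) = card (ordered_triples n (1, 9, 4))"
      by (elim insertE emptyE; simp only:) (metis swap1 swap2)+
  qed
  also have "\<dots> = 6 * card (ordered_triples n (1, 9, 4))" by simp
  finally show ?thesis .
qed

section \<open>Choice of square roots and the bijection with \<open>triples\<close>\<close>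

text \<open>The residue conditions select one of the two roots of each square: squares that are 1,
  9, 4 modulo 16 have roots congruent to 1 or -1, to 3 or -3, and to 2 or -2 modulo 8. The last root
  is written 2c.\<close>

definition root_triples :: "nat \<Rightarrow> (int \<times> int \<times> int) set" where
  "root_triples n = {(a, b, c). a mod 8 = 1 \<and> b mod 8 = 3 \<and> c \<in> C \<and> a\<^sup>2 + b\<^sup>2 + 4 * c\<^sup>2 = 2 * int n}"

lemma square_residue:
  fixes a r :: int
  assumes "a mod 8 = r"
  shows "a\<^sup>2 mod 16 = r\<^sup>2 mod 16"
proof -
  obtain q where "a = 8 * q + r" using assms by (metis mult_div_mod_eq)
  then have "a\<^sup>2 = r\<^sup>2 + 16 * (4 * q\<^sup>2 + q * r)"
    by (simp add: power2_eq_square algebra_simps)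
  then show ?thesis by (metis mod_mult_self2)
qed

text \<open>A square modulo 16 depends only on its root modulo 8. For r = 1 or 3 only the classes of
  r and -r have square r^2, so a root or its negative serves.\<close>

lemma square_root_residue:
  assumes "is_square m" "m mod 16 = nat (r\<^sup>2)" "r \<in> {1, 3}"
  obtains a :: int where "int m = a\<^sup>2" "a mod 8 = r"
proof -
  obtain k :: int where k: "int m = k\<^sup>2" using assms(1) is_square_iff_int by blast
  have "0 \<le> k mod 8" "k mod 8 < 8" by simp_all
  then have "k mod 8 \<in> {0, 1, 2, 3, 4, 5, 6, 7}" by auto
  moreover have "int m mod 16 = r\<^sup>2" using assms(2) by (metis int_nat_eq of_nat_mod of_nat_numeral zero_le_power2)
  then have "(k mod 8)\<^sup>2 mod 16 = r\<^sup>2" using square_residue[OF refl, of k] k by simp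
  ultimately have "k mod 8 = r \<or> k mod 8 = 8 - r"
    using assms(3) by (elim insertE emptyE) simp_all
  moreover have "(- k) mod 8 = r" if "k mod 8 = 8 - r"
  proof -
    have "k = 8 * (k div 8) + (8 - r)" using mult_div_mod_eq[of 8 k] unfolding that by (rule sym)
    then obtain q where q: "k = 8 * q + (8 - r)" ..
    have "- k = 8 * (- q - 1) + r" unfolding q by simp
    then have "(- k) mod 8 = r mod 8" by (metis mod_mult_self4 mult.commute)
    then show ?thesis using assms(3) by auto
  qed
  ultimately have "k mod 8 = r \<or> (- k) mod 8 = r" by blast
  then show ?thesis using that[of k] that[of "- k"] k by auto
qed

text \<open>The root is twice an odd number, since twice an even number has square divisible by
  16.\<close>

lemma C_square_root:
  assumes "is_square m" "m mod 16 = 4"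
  obtains c where "c \<in> C" "int m = 4 * c\<^sup>2"
proof -
  obtain k where k: "m = k\<^sup>2" using assms(1) by (auto simp: is_nth_power_def)
  have "even m" using assms(2) by presburger
  then have "even k" by (simp add: k)
  then obtain j where j: "k = 2 * j" by blast
  have "odd j"
  proof
    assume "even j"
    then obtain i where "j = 2 * i" by blast
    then have "m = 16 * i\<^sup>2" by (simp add: k j power_mult_distrib)
    with assms(2) show False by simp
  qed
  then obtain c where "c \<in> C" "c\<^sup>2 = (int j)\<^sup>2"
    using odd_C_cases[of "int j"] by (metis even_of_nat power2_minus)
  then show ?thesis by (intro that[of c]) (simp_all add: k j power_mult_distrib)
qed

text \<open>If y = -x, equal residues would make 2x vanish modulo k. This gives injectivity of
  passing from chosen roots to squares.\<close>

lemma square_eq_same_residue: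
  fixes x y :: int
  assumes "x\<^sup>2 = y\<^sup>2" "x mod k = y mod k" "(2 * x) mod k \<noteq> 0"
  shows "x = y"
proof (rule ccontr)
  assume "x \<noteq> y"
  with assms(1) have "y = - x" by (auto simp: power2_eq_iff)
  with assms(2) have "(x + x) mod k = (x + - x) mod k" by (metis mod_add_cong)
  with assms(3) show False by simp
qed

lemma card_root_triples: "card (root_triples n) = card (ordered_triples n (1, 9, 4))"
proof (rule bij_betw_same_card)
  let ?f = "\<lambda>p. (nat ((fst p)\<^sup>2), nat ((fst (snd p))\<^sup>2), nat (4 * (snd (snd p))\<^sup>2))"
  show "bij_betw ?f (root_triples n) (ordered_triples n (1, 9, 4))"
    unfolding bij_betw_def
  proof
    show "inj_on ?f (root_triples n)"
    proof (rule inj_onI)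
      fix p q assume pq: "p \<in> root_triples n" "q \<in> root_triples n" "?f p = ?f q"
      obtain a b c where p: "p = (a, b, c)" by (cases p) auto
      obtain a' b' c' where q: "q = (a', b', c')" by (cases q) auto
      have *: "a mod 8 = 1" "a' mod 8 = 1" "b mod 8 = 3" "b' mod 8 = 3" "c mod 4 = 1" "c' mod 4 = 1"
        using pq(1,2) by (auto simp: p q root_triples_def C_def)
      have "(2 * a) mod 8 \<noteq> 0" "(2 * b) mod 8 \<noteq> 0" "(2 * c) mod 4 \<noteq> 0" using * by presburger+
      moreover have "a\<^sup>2 = a'\<^sup>2" "b\<^sup>2 = b'\<^sup>2" "c\<^sup>2 = c'\<^sup>2"
        using pq(3) by (simp_all add: p q eq_nat_nat_iff)
      ultimately show "p = q"
        using * unfolding p q by (metis square_eq_same_residue)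
    qed
    show "?f ` root_triples n = ordered_triples n (1, 9, 4)"
    proof
      show "?f ` root_triples n \<subseteq> ordered_triples n (1, 9, 4)"
      proof (rule image_subsetI)
        fix p assume "p \<in> root_triples n"
        moreover obtain a b c where p: "p = (a, b, c)" by (cases p) auto
        ultimately have *: "a mod 8 = 1" "b mod 8 = 3" "c \<in> C" "a\<^sup>2 + b\<^sup>2 + 4 * c\<^sup>2 = 2 * int n"
          by (auto simp: root_triples_def)
        have nat_mod: "nat x mod 16 = nat r" if "x mod 16 = r" "0 \<le> x" for x r
          using that nat_mod_distrib[of x 16] by simp
        have "a\<^sup>2 mod 16 = 1" "b\<^sup>2 mod 16 = 9"
          using *(1,2)[THEN square_residue] by simp_all
        moreover have "(4 * c\<^sup>2) mod 16 = 4" using *(3) by (rule C_square_mod)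
        moreover have "0 \<le> 4 * c\<^sup>2" by simp
        moreover have "nat (1 :: int) = 1" "nat (9 :: int) = 9" "nat (4 :: int) = 4" by simp_all
        ultimately have "nat (a\<^sup>2) mod 16 = 1" "nat (b\<^sup>2) mod 16 = 9" "nat (4 * c\<^sup>2) mod 16 = 4"
          using nat_mod zero_le_power2 by metis+
        moreover have "4 * c\<^sup>2 = (2 * c)\<^sup>2" by (simp add: power_mult_distrib)
        then have "is_square (nat (a\<^sup>2))" "is_square (nat (b\<^sup>2))" "is_square (nat (4 * c\<^sup>2))"
          unfolding is_square_iff_int by (metis int_nat_eq zero_le_power2)+
        moreover have "2 * n = nat (a\<^sup>2) + nat (b\<^sup>2) + nat (4 * c\<^sup>2)"
          using *(4) by (simp add: nat_add_distrib[symmetric])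
        ultimately show "?f p \<in> ordered_triples n (1, 9, 4)"
          unfolding ordered_triples_def p by (simp only: fst_conv snd_conv prod.case mem_Collect_eq simp_thms)
      qed
      show "ordered_triples n (1, 9, 4) \<subseteq> ?f ` root_triples n"
      proof
        fix p assume "p \<in> ordered_triples n (1, 9, 4)"
        moreover obtain s1 s2 s3 where p: "p = (s1, s2, s3)" by (cases p) auto
        ultimately have *: "is_square s1" "is_square s2" "is_square s3" "2 * n = s1 + s2 + s3"
          "s1 mod 16 = 1" "s2 mod 16 = 9" "s3 mod 16 = 4"
          by (auto simp: ordered_triples_def)
        obtain a :: int where a: "int s1 = a\<^sup>2" "a mod 8 = 1"
          using square_root_residue[of s1 1] * by auto
        obtain b :: int where b: "int s2 = b\<^sup>2" "b mod 8 = 3"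
          using square_root_residue[of s2 3] * by auto
        obtain c where c: "c \<in> C" "int s3 = 4 * c\<^sup>2"
          using C_square_root[of s3] * by auto
        have "2 * int n = int s1 + int s2 + int s3" using *(4) by linarith
        then have "(a, b, c) \<in> root_triples n"
          using a b c by (simp add: root_triples_def)
        moreover have "p = ?f (a, b, c)"
          by (simp add: p flip: a(1) b(1) c(2))
        ultimately show "p \<in> ?f ` root_triples n" by (rule rev_image_eqI)
      qed
    qed
  qed
qed

text \<open>The sign of $w$ is chosen such that $2w - u$ is congruent to 1 modulo 8.\<close>

definition twist :: "int \<Rightarrow> int \<Rightarrow> int" where
  "twist u w = (if u mod 8 = 1 then w else - w)"

text \<open>With a = 2w - u and b = 2w + u one has a^2 + b^2 = 2(u^2 + 4w^2), inverted by u = (b -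
  a)/2 and w = (a + b)/4. Twisting w makes a and b congruent to 1 and 3 modulo 8; the twist depends
  on u alone and is an involution.\<close>

lemma card_triples: "card (triples n) = card (root_triples n)"
proof (rule bij_betw_same_card)
  let ?f = "\<lambda>p. let u = fst (fst p); w = twist u (snd p) in (2 * w - u, 2 * w + u, snd (fst p))"
  let ?g = "\<lambda>p. let u = (fst (snd p) - fst p) div 2 in
    ((u, snd (snd p)), twist u ((fst p + fst (snd p)) div 4))"
  have twist_twist: "twist u (twist u w) = w" for u w
    by (simp add: twist_def)
  have twist_square: "(twist u w)\<^sup>2 = w\<^sup>2" for u w
    by (simp add: twist_def)
  show "bij_betw ?f (triples n) (root_triples n)"
  proof (rule bij_betw_byWitness[where f' = ?g])
    show "\<forall>p\<in>triples n. ?g (?f p) = p"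
      by (simp add: twist_twist Let_def)
    show "\<forall>p\<in>root_triples n. ?f (?g p) = p"
    proof
      fix p assume "p \<in> root_triples n"
      moreover obtain a b c where p: "p = (a, b, c)" by (cases p) auto
      ultimately have "a mod 8 = 1" "b mod 8 = 3" by (auto simp: root_triples_def)
      \<comment> \<open>Modulo 8, a + b is 4 and b - a is 2, so both divisions are exact.\<close>
      then have "2 * ((a + b) div 4) - (b - a) div 2 = a" "2 * ((a + b) div 4) + (b - a) div 2 = b"
        by presburger+
      then show "?f (?g p) = p" unfolding p Let_def fst_conv snd_conv twist_twist by (simp only:)
    qed
    show "?f ` triples n \<subseteq> root_triples n"
    proof (rule image_subsetI)
      fix p assume "p \<in> triples n"
      moreover obtain u c w where p: "p = ((u, c), w)" by (metis surj_pair)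
      ultimately have *: "u mod 4 = 1" "c \<in> C" "w mod 4 = 1" "u\<^sup>2 + 2 * c\<^sup>2 + 4 * w\<^sup>2 = int n"
        by (auto simp: triples_def C_def)
      have "(2 * twist u w - u) mod 8 = 1 \<and> (2 * twist u w + u) mod 8 = 3"
      proof -
        have r: "(8 * x + 1) mod 8 = 1" "(8 * x + 3) mod 8 = 3" for x :: int by simp_all
        obtain j where w: "w = 4 * j + 1" using *(3) C_cases[of w] by (auto simp: C_def)
        have "u mod 8 = 1 \<or> u mod 8 = 5" using *(1) by presburger
        then show ?thesis
        proof
          assume "u mod 8 = 1"
          moreover from this obtain k where "u = 8 * k + 1" by (metis mult_div_mod_eq)
          ultimately have "2 * twist u w - u = 8 * (j - k) + 1" "2 * twist u w + u = 8 * (j + k) + 3"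
            by (simp_all add: twist_def w)
          then show ?thesis by (simp only: r)
        next
          assume "u mod 8 = 5"
          moreover from this obtain k where "u = 8 * k + 5" by (metis mult_div_mod_eq)
          ultimately have "2 * twist u w - u = 8 * (- j - k - 1) + 1" "2 * twist u w + u = 8 * (k - j) + 3"
            by (simp_all add: twist_def w)
          then show ?thesis by (simp only: r)
        qed
      qed
      moreover have "(2 * twist u w - u)\<^sup>2 + (2 * twist u w + u)\<^sup>2 + 4 * c\<^sup>2 = 2 * int n"
        unfolding *(4)[symmetric] twist_square[of u w, symmetric]
        by (simp add: power2_eq_square algebra_simps)
      ultimately show "?f p \<in> root_triples n"
        using *(2) by (simp add: p root_triples_def Let_def)
    qed
    show "?g ` root_triples n \<subseteq> triples n"
    proof (rule image_subsetI)
      fix p assume "p \<in> root_triples n"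
      moreover obtain a b c where p: "p = (a, b, c)" by (cases p) auto
      ultimately have *: "a mod 8 = 1" "b mod 8 = 3" "c \<in> C" "a\<^sup>2 + b\<^sup>2 + 4 * c\<^sup>2 = 2 * int n"
        by (auto simp: root_triples_def)
      define u w where "u = (b - a) div 2" and "w = (a + b) div 4"
      have ab: "a = 2 * w - u" "b = 2 * w + u"
        unfolding u_def w_def using *(1,2) by presburger+
      have "u mod 4 = 1" using *(1,2) unfolding u_def by presburger
      moreover have "twist u w mod 4 = 1"
      proof -
        have r: "(4 * x + 1) mod 4 = 1" for x :: int by simp
        obtain x where x: "2 * w - u = 8 * x + 1" using *(1) ab by (metis mult_div_mod_eq)
        have "u mod 8 = 1 \<or> u mod 8 = 5" using \<open>u mod 4 = 1\<close> by presburger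
        then show ?thesis
        proof
          assume "u mod 8 = 1"
          moreover from this obtain k where "u = 8 * k + 1" by (metis mult_div_mod_eq)
          ultimately have "twist u w = 4 * (x + k) + 1"
            using x by (simp add: twist_def)
          then show ?thesis by (simp only: r)
        next
          assume "u mod 8 = 5"
          moreover from this obtain k where "u = 8 * k + 5" by (metis mult_div_mod_eq)
          ultimately have "twist u w = 4 * (- x - k - 1) + 1"
            using x by (simp add: twist_def)
          then show ?thesis by (simp only: r)
        qed
      qed
      moreover have "u\<^sup>2 + 2 * c\<^sup>2 + 4 * w\<^sup>2 = int n"
        using *(4) unfolding ab by (simp add: power2_eq_square algebra_simps)
      ultimately show "?g p \<in> triples n"
        using *(3) unfolding triples_def by (simp add: p C_def twist_square Let_def flip: u_def w_def)
    qed
  qed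
qed

section \<open>Comparison of parities\<close>

lemma of_nat_bit_eq_1_iff: "(of_nat k :: bit) = 1 \<longleftrightarrow> odd k"
  by (induction k) auto

theorem theorem3p8:
  fixes n :: nat
  assumes "[n = 7] (mod 16)"
  shows "n \<in> B \<longleftrightarrow> [R3 n = 2] (mod 4)"
proof -
  have "inverse g $ n = proj 16 7 (inverse g) $ n"
    using assms by (simp add: proj_def)
  also have "\<dots> = (h * h ^ 2 * h ^ 4) $ n"
    using assms by (simp add: proj_inverse_g) (simp add: proj_def)
  also have "\<dots> = of_nat (card (triples n))"
    by (rule h7_nth)
  finally have "n \<in> B \<longleftrightarrow> odd (card (triples n))"
    by (simp add: B_def b_def of_nat_bit_eq_1_iff)
  moreover have "R3 n = 6 * card (triples n)"
    using R3_eq[OF assms] by (simp add: card_triples card_root_triples)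
  then have "[R3 n = 2] (mod 4) \<longleftrightarrow> odd (card (triples n))"
  proof -
    \<comment> \<open>6c is 2c modulo 4, which is 2 for odd c and 0 for even c.\<close>
    have "6 * c mod 4 = 2 mod (4 :: nat) \<longleftrightarrow> odd c" for c
    proof (cases "even c")
      case False
      then obtain k where "c = 2 * k + 1" by (elim oddE)
      then have "6 * c = 4 * (3 * k + 1) + 2" by simp
      then have "6 * c mod 4 = 2 mod 4" by (simp only: mod_mult_self4)
      with False show ?thesis by simp
    qed (auto elim!: evenE)
    then show ?thesis by (simp only: cong_def \<open>R3 n = 6 * card (triples n)\<close>)
  qed
  ultimately show ?thesis by simp
qed

end
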